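(* Let $r,l\in\mathbb{N}$, let $m,n_1,\ldots,n_r\in\mathbb{N}_0$, and let $b_1,\ldots,b_r,d\in\mathbb{C}$. Assume that $(1-d)_{m+l}\neq 0$ and that $(b_q-n_q)_m\neq 0$ for $q=1,\ldots,r$. Then $$ {}_{r+2}F_{r+1}\!\left[\begin{matrix}-m,\ b_1,\ldots,b_r,\ 1-d\\ b_1-n_1,\ldots,b_r-n_r,\ 1-d+l\end{matrix};1\right] =\frac{(1-d)_l}{(1-d)_{m+l}}\sum_{j=0}^{m}\binom{m}{j}(l)_{m-j}(1-d)_j\; {}_{r+1}F_r\!\left[\begin{matrix}-j,\ b_1,\ldots,b_r\\ b_1-n_1,\ldots,b_r-n_r\end{matrix};1\right]. $$
   Context: $\mathbb{N}=\{1,2,\ldots\}$ and $\mathbb{N}_0=\{0,1,2,\ldots\}$. Shifted factorial: $(\alpha)_0=1$ and $(\alpha)_n=\prod_{i=0}^{n-1}(\alpha+i)$ for $n\ge1$. For $N\in\mathbb{N}_0$, the terminating hypergeometric series at argument $1$ with numerator parameter $-N$ is the finite sum $$ {}_{s+1}F_s\!\left[\begin{matrix}-N,\ a_1,\ldots,a_s\\ c_1,\ldots,c_s\end{matrix};1\right]=\sum_{k=0}^{N}\frac{(-N)_k(a_1)_k\cdots(a_s)_k}{(c_1)_k\cdots(c_s)_k}\frac{1}{k!}. $$ *)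

theory Defs
  imports Complex_Main
begin

(* The terminating hypergeometric series at argument 1 with numerator parameters -N and as
   and denominator parameters cs. The parameter -N is passed as the natural number N, which
   is also the upper summation limit. It is an (s+1)Fs series when length as = length cs = s;
   its value is meaningful when pochhammer c N is nonzero for every c in cs. *)
definition hyp_term :: "nat \<Rightarrow> complex list \<Rightarrow> complex list \<Rightarrow> complex" where
  "hyp_term N as cs =
    (\<Sum>k=0..N. pochhammer (- of_nat N) k * (\<Prod>a\<leftarrow>as. pochhammer a k)
      / (\<Prod>c\<leftarrow>cs. pochhammer c k) * (1 / fact k))"

end

theory Submission
  imports Defs
begin

text \<open>
  Both sides of the transformation are linear in the coefficients
  \<open>A k = (\<Prod>a\<leftarrow>as. pochhammer a k) / (\<Prod>c\<leftarrow>cs. pochhammer c k) / fact k\<close>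
  of the inner series, so it suffices to compare the factors multiplying each \<open>A k\<close>. With
  \<open>x = 1 - d\<close> and \<open>y = l\<close>, interchanging the order of summation on the right leaves the sum
  over \<open>j\<close> from \<open>k\<close> to \<open>m\<close>. There \<open>(m choose j) * pochhammer (- j) k\<close> equals
  \<open>pochhammer (- m) k * ((m - k) choose (j - k))\<close>, and \<open>pochhammer x j\<close> splits off
  \<open>pochhammer x k\<close>; what remains is the Chu--Vandermonde sum for
  \<open>pochhammer (x + k + y) (m - k)\<close>. Dividing by \<open>pochhammer (x + y) m\<close> turns it into
  \<open>1 / pochhammer (x + y) k\<close>, the factor contributed by the additional denominator parameter.
\<close>

text \<open>
  Up to the sign \<open>(-1)^k\<close> and a factor \<open>fact k\<close>, \<open>pochhammer (- j) k\<close> is \<open>j choose k\<close>, so this is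
  the trinomial revision \<open>(m choose j) * (j choose k) = (m choose k) * ((m - k) choose (j - k))\<close>.
\<close>

lemma binomial_times_pochhammer_minus:
  assumes "k \<le> j" "j \<le> m"
  shows "of_nat (m choose j) * pochhammer (- of_nat j) k =
    (pochhammer (- of_nat m) k * of_nat ((m - k) choose (j - k)) :: 'a :: field_char_0)"
proof -
  have minus: "pochhammer (- of_nat p) k = ((-1) ^ k * fact k * of_nat (p choose k) :: 'a)" for p
    by (simp add: binomial_gbinomial gbinomial_pochhammer)
  have "of_nat (m choose j) * of_nat (j choose k) =
      (of_nat (m choose k) * of_nat ((m - k) choose (j - k)) :: 'a)"
    using choose_mult[OF assms] by (metis of_nat_mult)
  then show ?thesis
    unfolding minus by (simp add: algebra_simps)
qed

text \<open>
  This is the factor that multiplies the \<open>k\<close>-th coefficient of the inner series after the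
  summations are interchanged. Once the factors depending only on \<open>k\<close> are taken out, the
  index shift \<open>j = i + k\<close> makes it a Chu--Vandermonde sum of length \<open>m - k\<close>.
\<close>

lemma binomial_pochhammer_tail_sum:
  fixes x y :: "'a :: field_char_0"
  assumes "k \<le> m"
  shows "(\<Sum>j=k..m. of_nat (m choose j) * pochhammer y (m - j) * pochhammer x j
            * pochhammer (- of_nat j) k)
    = pochhammer (- of_nat m) k * pochhammer x k * pochhammer (x + y + of_nat k) (m - k)"
proof -
  have "(\<Sum>j=k..m. of_nat (m choose j) * pochhammer y (m - j) * pochhammer x j
            * pochhammer (- of_nat j) k)
    = (\<Sum>j=k..m. pochhammer (- of_nat m) k * pochhammer x k *
        (of_nat ((m - k) choose (j - k)) * pochhammer (x + of_nat k) (j - k) * pochhammer y (m - j)))"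
  proof (rule sum.cong[OF refl])
    fix j assume "j \<in> {k..m}"
    then have "k \<le> j" "j \<le> m" by auto
    then show "of_nat (m choose j) * pochhammer y (m - j) * pochhammer x j
            * pochhammer (- of_nat j) k = pochhammer (- of_nat m) k * pochhammer x k *
        (of_nat ((m - k) choose (j - k)) * pochhammer (x + of_nat k) (j - k) * pochhammer y (m - j))"
      using binomial_times_pochhammer_minus[of k j m, where 'a = 'a] pochhammer_product[of k j x]
      by (simp add: algebra_simps)
  qed
  also have "\<dots> = (\<Sum>i\<le>m - k. pochhammer (- of_nat m) k * pochhammer x k *
        (of_nat ((m - k) choose i) * pochhammer (x + of_nat k) i * pochhammer y (m - k - i)))"
    by (rule sum.reindex_bij_witness[of _ "\<lambda>i. i + k" "\<lambda>j. j - k"]) (use assms in auto)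
  also have "\<dots> = pochhammer (- of_nat m) k * pochhammer x k *
      pochhammer (x + of_nat k + y) (m - k)"
    by (simp only: pochhammer_binomial_sum sum_distrib_left)
  finally show ?thesis
    by (simp add: ac_simps)
qed

text \<open>
  The series with the extra parameter pair is a weighted average of the truncations of the
  series without it: the case \<open>k = 0\<close> of the preceding sum shows that the weights
  \<open>(m choose j) * pochhammer y (m - j) * pochhammer x j\<close> add up to \<open>pochhammer (x + y) m\<close>,
  and the cases \<open>k > 0\<close> match the remaining coefficients.
\<close>

lemma hyp_term_remove_parameter_pair:
  assumes nz: "pochhammer (x + y) m \<noteq> 0"
  shows "hyp_term m (as @ [x]) (cs @ [x + y]) =
    (\<Sum>j=0..m. of_nat (m choose j) * pochhammer y (m - j) * pochhammer x j * hyp_term j as cs)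
      / pochhammer (x + y) m"
proof -
  define A where "A k = (\<Prod>a\<leftarrow>as. pochhammer a k) / (\<Prod>c\<leftarrow>cs. pochhammer c k) / fact k" for k
  define w where "w j = of_nat (m choose j) * pochhammer y (m - j) * pochhammer x j" for j
  have "(\<Sum>j=0..m. w j * hyp_term j as cs) =
      (\<Sum>j=0..m. \<Sum>k=0..j. w j * pochhammer (- of_nat j) k * A k)"
    by (simp add: hyp_term_def A_def sum_distrib_left mult_ac)
  also have "\<dots> = (\<Sum>k=0..m. \<Sum>j=k..m. w j * pochhammer (- of_nat j) k * A k)"
    unfolding sum.Sigma[OF finite_atLeastAtMost ballI[OF finite_atLeastAtMost]]
    by (rule sum.reindex_bij_witness[of _ prod.swap prod.swap]) auto
  also have "\<dots> = (\<Sum>k=0..m. pochhammer (- of_nat m) k * pochhammer x k *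
      pochhammer (x + y + of_nat k) (m - k) * A k)"
    unfolding w_def
    by (simp add: sum_distrib_right[symmetric] binomial_pochhammer_tail_sum)
  also have "\<dots> / pochhammer (x + y) m = hyp_term m (as @ [x]) (cs @ [x + y])"
    unfolding hyp_term_def sum_divide_distrib
  proof (rule sum.cong[OF refl])
    fix k assume "k \<in> {0..m}"
    then have "pochhammer (x + y) m = pochhammer (x + y) k * pochhammer (x + y + of_nat k) (m - k)"
      by (intro pochhammer_product) simp
    with nz show "pochhammer (- of_nat m) k * pochhammer x k *
          pochhammer (x + y + of_nat k) (m - k) * A k / pochhammer (x + y) m
        = pochhammer (- of_nat m) k * (\<Prod>a\<leftarrow>as @ [x]. pochhammer a k)
          / (\<Prod>c\<leftarrow>cs @ [x + y]. pochhammer c k) * (1 / fact k)"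
      by (simp add: A_def mult_ac)
  qed
  finally show ?thesis
    by (simp add: w_def)
qed

theorem theorem3p7:
  fixes r l m :: nat
    and n :: "nat \<Rightarrow> nat"
    and b :: "nat \<Rightarrow> complex"
    and d :: complex
  assumes "r \<ge> 1" and "l \<ge> 1"
    and "pochhammer (1 - d) (m + l) \<noteq> 0"
    and "\<And>q. q \<in> {1..r} \<Longrightarrow> pochhammer (b q - of_nat (n q)) m \<noteq> 0"
  shows "hyp_term m
           (map b [1..<r+1] @ [1 - d])
           (map (\<lambda>q. b q - of_nat (n q)) [1..<r+1] @ [1 - d + of_nat l])
       = pochhammer (1 - d) l / pochhammer (1 - d) (m + l) *
         (\<Sum>j=0..m. of_nat (m choose j) * pochhammer (of_nat l) (m - j) * pochhammer (1 - d) j *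
            hyp_term j (map b [1..<r+1]) (map (\<lambda>q. b q - of_nat (n q)) [1..<r+1]))"
proof -
  have split: "pochhammer (1 - d) (m + l) =
      pochhammer (1 - d) l * pochhammer (1 - d + of_nat l) m"
    using pochhammer_product'[of "1 - d" l m] by (simp add: add.commute)
  with assms(3) have nz: "pochhammer (1 - d) l \<noteq> 0" "pochhammer (1 - d + of_nat l) m \<noteq> 0"
    by auto
  show ?thesis
    unfolding hyp_term_remove_parameter_pair[OF nz(2)] split using nz(1) by simp
qed

end
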